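(* For every real $\epsilon>0$ there exists a constant $K(\epsilon)>0$, depending only on $\epsilon$, such that the following holds. Let $\alpha,\beta$ be real numbers in $(0,1]$, and let $\mathcal{A}$ and $\mathcal{B}$ be infinite sequences of integers with upper asymptotic densities $\alpha$ and $\beta$ respectively. Then there are infinitely many pairs of consecutive terms of the product sequence $\mathcal{A}.\mathcal{B}$ the difference between which is at most $$\frac{K(\epsilon)}{(\alpha\beta)^{1+\epsilon}} .$$
   Context: Sequences of integers are identified with the sets of their terms. The upper asymptotic density of $\mathcal{A}$ is $\overline{d}(\mathcal{A})=\limsup_{x\to\infty}\frac{|\mathcal{A}\cap[1,x]|}{x}$. The product sequence $\mathcal{A}.\mathcal{B}$ is the sequence whose terms are the integers of the form $ab$ with $a\in\mathcal{A}$ and $b\in\mathcal{B}$; its terms are taken to be distinct and listed in increasing order, so two terms $u<v$ are consecutive if no term of $\mathcal{A}.\mathcal{B}$ lies strictly between them, and their difference is $v-u>0$. *)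

theory Defs
  imports Complex_Main "HOL-Library.Extended_Real" "HOL-Library.Set_Algebras"
begin

definition upper_density :: "int set \<Rightarrow> ereal" where
  "upper_density A =
     Limsup at_top (\<lambda>x::real. ereal (real (card {a \<in> A. 1 \<le> a \<and> real_of_int a \<le> x}) / x))"

definition consecutive_in :: "int set \<Rightarrow> int \<Rightarrow> int \<Rightarrow> bool" where
  "consecutive_in S u v \<longleftrightarrow>
     u \<in> S \<and> v \<in> S \<and> u < v \<and> (\<forall>w \<in> S. \<not> (u < w \<and> w < v))"

text \<open>
  A sequence of integers is represented by the set of its terms. The product sequence of
  \<open>A\<close> and \<open>B\<close> is the elementwise product \<open>A * B\<close> of \<open>HOL-Library.Set_Algebras\<close>; since it is a
  set, its terms are distinct by construction.
\<close>

end

theory Submission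
  imports Defs "HOL-Computational_Algebra.Primes"
begin

text \<open>
  Take long initial segments \<open>[1, X]\<close> and \<open>[1, Y]\<close> in which \<open>A\<close> and \<open>B\<close> have densities
  comparable to their upper densities, and regard the pairs \<open>(a, b) \<in> A \<times> B\<close> as points of the
  rectangle \<open>[1, X] \<times> [1, Y]\<close>. For two such points the determinant \<open>a' * b - a * b'\<close> is a difference of
  two elements of the product set, and geometrically it is twice the area of the triangle that they
  span with the origin. If \<open>\<gamma> = \<alpha> * \<beta>\<close> is the density of the points, up to a constant, then
  some sector with apex at the origin and area about \<open>1 / \<gamma>\<close> contains two points, and their
  determinant is \<open>O(1 / \<gamma>)\<close>.

  This gives nothing if the two points lie on the same line through the origin, for then the
  determinant is 0. The points with a fixed greatest common divisor \<open>m\<close> have distinct slopes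
  (\<open>distinct_slopes_fixed_gcd\<close>). So if there are \<open>P\<close> of them, the pigeonhole principle yields a
  positive determinant of size \<open>O(X * Y / P)\<close> (\<open>small_determinant\<close>), and it remains to find an \<open>m\<close>
  for which \<open>P\<close> is at least a constant times \<open>\<gamma> powr (1 + \<epsilon>) * X * Y\<close>
  (\<open>exists_large_gcd_class\<close>).

  Greatest common divisors above \<open>G \<approx> 4 / \<gamma>\<close> occur for too few pairs to matter. A class is
  contained in the product of the multiples of \<open>m\<close> in \<open>A\<close> and those in \<open>B\<close>, so it suffices that
  the points cannot be spread evenly over many classes \<open>m \<le> G\<close>. This holds because the
  elements of \<open>A\<close> have on average only \<open>O(G powr \<epsilon>)\<close> divisors up to \<open>G\<close>, and likewise for \<open>B\<close>
  (\<open>sum_card_multiples_le\<close>). Since \<open>A\<close> is an arbitrary set, an average over all integers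
  up to \<open>X\<close> is not enough here. But passing from all these integers to a subset of density at least
  \<open>1 / G\<close> raises the average of the \<open>l\<close>-th power of this divisor count at most by a factor \<open>G\<close>, which
  is negligible for the count itself when \<open>l\<close> is large; and the average over all integers is
  controlled by the divisor bound (\<open>small_divisor_moment_bound\<close>, \<open>divisor_bound\<close>).
\<close>

section \<open>The divisor bound\<close>

lemma card_divisors_prime_power_mult_le:
  fixes p m e :: nat
  assumes "prime p" "m > 0"
  shows "card {d. d dvd p ^ e * m} \<le> (e + 1) * card {d. d dvd m}"
proof -
  have fin: "finite ({..e} \<times> {d. d dvd m})"
    using assms by auto
  have "{d. d dvd p ^ e * m} \<subseteq> (\<lambda>(i, d). p ^ i * d) ` ({..e} \<times> {d. d dvd m})"
  proof
    fix d assume "d \<in> {d. d dvd p ^ e * m}"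
    then obtain u v where uv: "d = u * v" "u dvd p ^ e" "v dvd m"
      using division_decomp[of d "p ^ e" m] by auto
    then obtain i where "i \<le> e" "u = p ^ i"
      using divides_primepow_nat[OF \<open>prime p\<close>] by auto
    then show "d \<in> (\<lambda>(i, d). p ^ i * d) ` ({..e} \<times> {d. d dvd m})"
      using uv by force
  qed
  from surj_card_le[OF fin this] show ?thesis
    by (simp add: card_cartesian_product)
qed

text \<open>
  Splitting off a full prime power \<open>p ^ e\<close> multiplies the number of divisors by \<open>e + 1\<close> and
  \<open>n powr \<delta>\<close> by \<open>p powr (e * \<delta>)\<close>. The second factor is at least \<open>2 ^ e \<ge> e + 1\<close> as soon as
  \<open>p powr \<delta> \<ge> 2\<close>. Each of the finitely many smaller primes loses at most a factor \<open>c\<close>, so the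
  total loss is bounded.
\<close>
lemma divisor_bound:
  fixes \<delta> :: real
  assumes "\<delta> > 0"
  shows "\<exists>C\<ge>1. \<forall>n::nat. n > 0 \<longrightarrow> real (card {d. d dvd n}) \<le> C * real n powr \<delta>"
proof -
  \<comment> \<open>Both \<open>c \<ge> 1\<close> and \<open>c * (\<delta> * ln 2) \<ge> 1\<close> hold, whence
    \<open>e + 1 \<le> c * (1 + e * \<delta> * ln 2) \<le> c * 2 powr (e * \<delta>)\<close>.\<close>
  define c where "c = 1 + 1 / (\<delta> * ln 2)"
  define P where "P = nat \<lceil>2 powr (1 / \<delta>)\<rceil>"
  define S where "S n = {p. prime p \<and> p dvd n \<and> p \<le> P}" for n :: nat
  have ln2: "ln 2 > (0::real)" by simp
  have c1: "c \<ge> 1" using assms ln2 by (simp add: c_def)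
  have c2: "c * (\<delta> * ln 2) \<ge> 1" using assms ln2 by (simp add: c_def field_simps)
  have finS: "finite (S n)" for n by (simp add: S_def)
  have small: "real (e + 1) \<le> c * (real p ^ e) powr \<delta>" if "prime p" for p e :: nat
  proof -
    have "real (e + 1) \<le> c + c * (\<delta> * ln 2) * e"
      using c1 mult_right_mono[OF c2, of "real e"] by simp
    also have "\<dots> = c * (1 + (e * \<delta>) * ln 2)" by (simp add: algebra_simps)
    also have "\<dots> \<le> c * exp ((e * \<delta>) * ln 2)"
      using c1 exp_ge_add_one_self by (intro mult_left_mono) auto
    also have "exp ((e * \<delta>) * ln 2) = 2 powr (e * \<delta>)" by (simp add: powr_def)
    also have "\<dots> \<le> real p powr (e * \<delta>)"
      using prime_ge_2_nat[OF that] assms by (intro powr_mono2) auto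
    also have "\<dots> = (real p ^ e) powr \<delta>"
      using prime_gt_0_nat[OF that] by (simp add: powr_powr flip: powr_realpow)
    finally show ?thesis using c1 by simp
  qed
  have large: "real (e + 1) \<le> (real p ^ e) powr \<delta>" if "prime p" "p > P" for p e :: nat
  proof -
    have "2 powr (1 / \<delta>) \<le> real P" unfolding P_def by linarith
    then have "(2 powr (1 / \<delta>)) powr \<delta> \<le> real p powr \<delta>"
      using that assms by (intro powr_mono2) auto
    then have "2 \<le> real p powr \<delta>" using assms by (simp add: powr_powr)
    then have "2 ^ e \<le> (real p powr \<delta>) ^ e" by (intro power_mono) auto
    moreover have "(real p powr \<delta>) ^ e = (real p ^ e) powr \<delta>"
      using prime_gt_0_nat[OF that(1)] by (simp add: powr_powr mult.commute flip: powr_realpow)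
    moreover have "e + 1 \<le> 2 ^ e" by (induction e) auto
    then have "real (e + 1) \<le> 2 ^ e" by (metis of_nat_le_iff of_nat_numeral of_nat_power)
    ultimately show ?thesis by linarith
  qed
  have main: "real (card {d. d dvd n}) \<le> c ^ card (S n) * real n powr \<delta>" if "n > 0" for n
    using that
  proof (induction n rule: less_induct)
    case (less n)
    show ?case
    proof (cases "n = 1")
      case True
      then show ?thesis using c1 by simp
    next
      case False
      then obtain p where p: "prime p" "p dvd n" using prime_factor_nat by blast
      have "n \<noteq> 0" "\<not> is_unit p" using less.prems p by auto
      then obtain m where m: "n = p ^ multiplicity p n * m" "\<not> p dvd m"
        by (metis multiplicity_decompose')
      define e where "e = multiplicity p n"
      have e: "n = p ^ e * m" using m(1) by (simp add: e_def)
      have "e > 0"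
        using p less.prems prime_elem_multiplicity_eq_zero_iff[of p n] by (auto simp: e_def)
      have "m > 0" using m less.prems by (cases m) auto
      have "1 < p ^ e" using \<open>e > 0\<close> prime_gt_1_nat[OF p(1)] by (intro one_less_power) auto
      then have "m < n" using \<open>m > 0\<close> e by simp
      have IH: "real (card {d. d dvd m}) \<le> c ^ card (S m) * real m powr \<delta>"
        using less.IH[OF \<open>m < n\<close> \<open>m > 0\<close>] .
      have "card {d. d dvd n} \<le> (e + 1) * card {d. d dvd m}"
        using card_divisors_prime_power_mult_le[OF p(1) \<open>m > 0\<close>] e by simp
      then have "real (card {d. d dvd n}) \<le> real (e + 1) * real (card {d. d dvd m})"
        by (metis of_nat_le_iff of_nat_mult)
      also have "\<dots> \<le> real (e + 1) * (c ^ card (S m) * real m powr \<delta>)"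
        by (intro mult_left_mono IH) auto
      also have "\<dots> \<le> c ^ card (S n) * real n powr \<delta>"
      proof -
        have n_powr: "real n powr \<delta> = (real p ^ e) powr \<delta> * real m powr \<delta>"
          using e by (simp add: powr_mult)
        show ?thesis
        proof (cases "p \<le> P")
          case True
          have "insert p (S m) \<subseteq> S n" using p True e by (auto simp: S_def)
          then have "card (insert p (S m)) \<le> card (S n)" using finS by (intro card_mono) auto
          moreover have "p \<notin> S m" using m(2) by (auto simp: S_def)
          ultimately have "c ^ Suc (card (S m)) \<le> c ^ card (S n)"
            using c1 finS by (intro power_increasing) auto
          moreover have "real (e + 1) * c ^ card (S m)
              \<le> c * (real p ^ e) powr \<delta> * c ^ card (S m)"
            using small[OF p(1), of e] c1 by (intro mult_right_mono) auto
          ultimately have "real (e + 1) * c ^ card (S m)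
              \<le> c ^ card (S n) * (real p ^ e) powr \<delta>"
            using mult_right_mono[of "c ^ Suc (card (S m))" "c ^ card (S n)" "(real p ^ e) powr \<delta>"]
            by (simp add: mult_ac)
          then have "real (e + 1) * c ^ card (S m) * real m powr \<delta>
              \<le> c ^ card (S n) * (real p ^ e) powr \<delta> * real m powr \<delta>"
            by (intro mult_right_mono) auto
          then show ?thesis by (simp only: n_powr mult.assoc)
        next
          case False
          have "S m \<subseteq> S n" using e by (auto simp: S_def)
          then have "card (S m) \<le> card (S n)" using finS by (intro card_mono) auto
          then have "c ^ card (S m) \<le> c ^ card (S n)"
            using c1 by (intro power_increasing) auto
          moreover have "real (e + 1) \<le> (real p ^ e) powr \<delta>"
            using large p(1) False by simp
          ultimately have "real (e + 1) * c ^ card (S m)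
              \<le> (real p ^ e) powr \<delta> * c ^ card (S n)"
            using c1 by (intro mult_mono) auto
          then have "real (e + 1) * c ^ card (S m) * real m powr \<delta>
              \<le> (real p ^ e) powr \<delta> * c ^ card (S n) * real m powr \<delta>"
            by (intro mult_right_mono) auto
          then show ?thesis by (simp only: n_powr mult_ac)
        qed
      qed
      finally show ?thesis .
    qed
  qed
  show ?thesis
  proof (intro exI[of _ "c ^ card {..P}"] conjI allI impI)
    show "1 \<le> c ^ card {..P}" using c1 by (rule one_le_power)
  next
    fix n :: nat assume "n > 0"
    have "card (S n) \<le> card {..P}" by (intro card_mono) (auto simp: S_def)
    then have "c ^ card (S n) \<le> c ^ card {..P}" using c1 by (intro power_increasing)
    then show "real (card {d. d dvd n}) \<le> c ^ card {..P} * real n powr \<delta>"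
      using main[OF \<open>n > 0\<close>] by (meson mult_right_mono order_trans powr_ge_zero)
  qed
qed

section \<open>Divisors up to a bound: moments and dense sets\<close>

lemma card_multiples_le:
  fixes m X :: nat
  assumes "m > 0"
  shows "real (card {a \<in> {1..X}. m dvd a}) \<le> real X / real m"
proof -
  have "{a \<in> {1..X}. m dvd a} \<subseteq> (\<lambda>k. m * k) ` {1..X div m}"
  proof
    fix a assume "a \<in> {a \<in> {1..X}. m dvd a}"
    then obtain k where k: "a = m * k" "1 \<le> a" "a \<le> X" by (auto elim: dvdE)
    then have "1 \<le> k" "k \<le> X div m"
      using assms by (auto simp: less_eq_div_iff_mult_less_eq mult.commute Suc_le_eq)
    then show "a \<in> (\<lambda>k. m * k) ` {1..X div m}" using k by auto
  qed
  then have "card {a \<in> {1..X}. m dvd a} \<le> X div m"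
    using surj_card_le[of "{1..X div m}"] by fastforce
  moreover have "real (X div m) \<le> real X / real m" by (rule of_nat_div_le_of_nat)
  ultimately show ?thesis by linarith
qed

lemma sum_inverse_le_ln:
  "(\<Sum>L = 1..N. 1 / real L) \<le> 1 + ln (real N)" if "N \<ge> 1"
  using that
proof (induction N rule: dec_induct)
  case base
  then show ?case by simp
next
  case (step n)
  have "ln (real n / real (Suc n)) \<le> real n / real (Suc n) - 1"
    using step by (intro ln_le_minus_one) auto
  then have "1 / real (Suc n) \<le> ln (real (Suc n)) - ln (real n)"
    using step by (simp add: ln_div field_simps)
  then show ?case using step by simp
qed

lemma Lcm_set_le_power:
  fixes G :: nat
  assumes "set xs \<subseteq> {1..G}"
  shows "Lcm (set xs) \<le> G ^ length xs"
  using assms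
proof (induction xs)
  case (Cons x xs)
  then have "0 \<notin> set xs" by auto
  then have "0 < Lcm (set xs)" by (metis Lcm_0_iff List.finite_set gr0I)
  moreover have "0 < x" using Cons.prems by simp
  ultimately have "lcm x (Lcm (set xs)) \<le> x * Lcm (set xs)"
    by (intro dvd_imp_le lcm_least mult_pos_pos) auto
  also have "\<dots> \<le> G * G ^ length xs" using Cons by (intro mult_le_mono) auto
  finally show ?case by simp
qed simp

text \<open>
  The left-hand side counts lists of \<open>l\<close> divisors of \<open>a\<close> that are at most \<open>G\<close>. The least common
  multiple of such a list is a divisor \<open>L \<le> G ^ l\<close> of \<open>a\<close>, and \<open>L\<close> determines the list up to a choice
  of \<open>l\<close> divisors of \<open>L\<close>.
\<close>
lemma power_card_small_divisors_le:
  fixes a G l :: nat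
  assumes "a > 0"
  shows "card {d \<in> {1..G}. d dvd a} ^ l
    \<le> (\<Sum>L | L \<in> {1..G ^ l} \<and> L dvd a. card {d. d dvd L} ^ l)"
proof -
  define D where "D = {d \<in> {1..G}. d dvd a}"
  define I where "I = {L \<in> {1..G ^ l}. L dvd a}"
  have "{xs. set xs \<subseteq> D \<and> length xs = l}
      \<subseteq> (\<Union>L\<in>I. {xs. set xs \<subseteq> {d. d dvd L} \<and> length xs = l})"
  proof
    fix xs assume "xs \<in> {xs. set xs \<subseteq> D \<and> length xs = l}"
    then have xs: "set xs \<subseteq> D" "length xs = l" by auto
    have "Lcm (set xs) dvd a" using xs by (auto simp: D_def intro!: Lcm_least)
    moreover from this have "0 < Lcm (set xs)" using assms by (rule dvd_pos_nat[rotated])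
    moreover have "Lcm (set xs) \<le> G ^ l"
      using Lcm_set_le_power[of xs G] xs by (fastforce simp: D_def)
    ultimately have "Lcm (set xs) \<in> I" by (simp add: I_def Suc_le_eq)
    then show "xs \<in> (\<Union>L\<in>I. {xs. set xs \<subseteq> {d. d dvd L} \<and> length xs = l})"
      using xs(2) by (intro UN_I[of "Lcm (set xs)"]) (auto intro: dvd_Lcm)
  qed
  moreover have finI: "finite I" by (simp add: I_def)
  moreover have fin: "finite {d. d dvd L}" if "L \<in> I" for L
    using that by (auto simp: I_def)
  ultimately have "card {xs. set xs \<subseteq> D \<and> length xs = l}
      \<le> (\<Sum>L\<in>I. card {xs. set xs \<subseteq> {d. d dvd L} \<and> length xs = l})"
    by (intro order_trans[OF card_mono card_UN_le] finite_UN_I finite_lists_length_eq) auto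
  also have "\<dots> = (\<Sum>L\<in>I. card {d. d dvd L} ^ l)"
    by (intro sum.cong refl card_lists_length_eq fin)
  also have "card {xs. set xs \<subseteq> D \<and> length xs = l} = card D ^ l"
    by (intro card_lists_length_eq) (simp add: D_def)
  finally show ?thesis by (simp add: D_def I_def)
qed

text \<open>
  On average over \<open>a \<le> X\<close>, every moment of the number of divisors up to \<open>G\<close> is bounded in terms of
  \<open>G\<close> by a power that does not grow with \<open>l\<close>; the numbers up to \<open>X\<close> themselves may have arbitrarily
  many divisors. The exponent 2 is generous: one factor \<open>G\<close> pays for the divisor bound applied to
  \<open>L \<le> G ^ l\<close>, the other one for the harmonic sum over \<open>L\<close>.
\<close>
lemma small_divisor_moment_bound:
  fixes l :: nat
  assumes "l \<ge> 1"
  shows "\<exists>C\<ge>1. \<forall>X G::nat. G \<ge> 1 \<longrightarrow>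
    (\<Sum>a = 1..X. real (card {d \<in> {1..G}. d dvd a}) ^ l) \<le> C * real X * real G ^ 2"
proof -
  \<comment> \<open>With this exponent \<open>(L powr \<delta>) ^ l \<le> G\<close> for \<open>L \<le> G ^ l\<close>.\<close>
  define \<delta> where "\<delta> = 1 / real l ^ 2"
  have "\<delta> > 0" using assms by (simp add: \<delta>_def)
  then obtain C where C: "C \<ge> 1"
      "\<And>n::nat. n > 0 \<Longrightarrow> real (card {d. d dvd n}) \<le> C * real n powr \<delta>"
    using divisor_bound by blast
  show ?thesis
  proof (intro exI[of _ "C ^ l * real l"] conjI allI impI)
    show "C ^ l * real l \<ge> 1" using C(1) assms mult_mono[of 1 "C ^ l" 1 "real l"] by simp
  next
    fix X G :: nat assume "G \<ge> 1"
    have tau: "real (card {d. d dvd L}) ^ l \<le> C ^ l * real G" if "L \<in> {1..G ^ l}" for L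
    proof -
      have "real L powr \<delta> \<le> real (G ^ l) powr \<delta>"
        using that \<open>\<delta> > 0\<close> by (intro powr_mono2) (auto simp del: of_nat_power)
      also have "\<dots> = real G powr (1 / real l)"
        using \<open>G \<ge> 1\<close> assms
        by (simp add: powr_powr \<delta>_def power2_eq_square flip: powr_realpow)
      finally have "C * real L powr \<delta> \<le> C * real G powr (1 / real l)"
        using C(1) by (intro mult_left_mono) auto
      moreover have "real (card {d. d dvd L}) \<le> C * real L powr \<delta>"
        using that by (intro C(2)) auto
      ultimately have "real (card {d. d dvd L}) \<le> C * real G powr (1 / real l)"
        by linarith
      then have "real (card {d. d dvd L}) ^ l \<le> (C * real G powr (1 / real l)) ^ l"
        by (intro power_mono) auto
      also have "\<dots> = C ^ l * (real G powr (1 / real l)) powr real l"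
        using \<open>G \<ge> 1\<close> by (simp add: power_mult_distrib powr_realpow)
      also have "\<dots> = C ^ l * real G" using \<open>G \<ge> 1\<close> assms by (simp add: powr_powr)
      finally show ?thesis .
    qed
    have "(\<Sum>a = 1..X. real (card {d \<in> {1..G}. d dvd a}) ^ l)
        \<le> (\<Sum>a = 1..X. \<Sum>L | L \<in> {1..G ^ l} \<and> L dvd a. real (card {d. d dvd L}) ^ l)"
    proof (intro sum_mono)
      fix a assume "a \<in> {1..X}"
      then have "real (card {d \<in> {1..G}. d dvd a} ^ l)
          \<le> real (\<Sum>L | L \<in> {1..G ^ l} \<and> L dvd a. card {d. d dvd L} ^ l)"
        by (intro of_nat_mono power_card_small_divisors_le) auto
      then show "real (card {d \<in> {1..G}. d dvd a}) ^ l
          \<le> (\<Sum>L | L \<in> {1..G ^ l} \<and> L dvd a. real (card {d. d dvd L}) ^ l)"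
        by simp
    qed
    also have "\<dots> = (\<Sum>L = 1..G ^ l. \<Sum>a | a \<in> {1..X} \<and> L dvd a. real (card {d. d dvd L}) ^ l)"
      by (rule sum.swap_restrict) auto
    also have "\<dots> \<le> (\<Sum>L = 1..G ^ l. real X / real L * (C ^ l * real G))"
    proof (intro sum_mono)
      fix L assume L: "L \<in> {1..G ^ l}"
      have "(\<Sum>a | a \<in> {1..X} \<and> L dvd a. real (card {d. d dvd L}) ^ l)
          = real (card {a \<in> {1..X}. L dvd a}) * real (card {d. d dvd L}) ^ l" by simp
      also have "\<dots> \<le> real X / real L * (C ^ l * real G)"
        using L tau[OF L] card_multiples_le[of L X] by (intro mult_mono) auto
      finally show "(\<Sum>a | a \<in> {1..X} \<and> L dvd a. real (card {d. d dvd L}) ^ l)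
          \<le> real X / real L * (C ^ l * real G)" .
    qed
    also have "\<dots> = C ^ l * real G * real X * (\<Sum>L = 1..G ^ l. 1 / real L)"
      by (simp add: sum_distrib_left mult_ac)
    also have "\<dots> \<le> C ^ l * real G * real X * (real l * real G)"
    proof (intro mult_left_mono)
      have "(\<Sum>L = 1..G ^ l. 1 / real L) \<le> 1 + ln (real (G ^ l))"
        using \<open>G \<ge> 1\<close> by (intro sum_inverse_le_ln) auto
      also have "\<dots> = 1 + real l * ln (real G)" using \<open>G \<ge> 1\<close> by (simp add: ln_realpow)
      also have "\<dots> \<le> 1 + real l * (real G - 1)"
        using \<open>G \<ge> 1\<close> by (intro add_left_mono mult_left_mono ln_le_minus_one) auto
      also have "\<dots> \<le> real l * real G" using assms by (simp add: algebra_simps)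
      finally show "(\<Sum>L = 1..G ^ l. 1 / real L) \<le> real l * real G" .
    qed (use C(1) in auto)
    finally show "(\<Sum>a = 1..X. real (card {d \<in> {1..G}. d dvd a}) ^ l)
        \<le> C ^ l * real l * real X * real G ^ 2"
      by (simp add: power2_eq_square mult_ac)
  qed
qed

text \<open>
  A set of density at least \<open>1 / G\<close> is so large that the high moments control its own divisor
  statistics: its elements have on average at most \<open>O(G powr (3 / l))\<close> divisors up to \<open>G\<close>.
  The sum over \<open>m\<close> is the sum over \<open>a \<in> A\<close> of these divisor counts \<open>f a\<close>. The counts
  below a threshold \<open>T\<close> contribute at most \<open>T * card A\<close>, and a count above it is at most
  \<open>f a ^ l / T ^ (l - 1)\<close>; \<open>T\<close> is chosen with \<open>T ^ l \<ge> C * G ^ 3\<close> to absorb the moment bound.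
\<close>
lemma sum_card_multiples_le:
  fixes l :: nat
  assumes "l \<ge> 1"
  shows "\<exists>M\<ge>1. \<forall>(X::nat) (G::nat) A. A \<subseteq> {1..X} \<longrightarrow> G \<ge> 1 \<longrightarrow> X \<le> G * card A \<longrightarrow>
    (\<Sum>m = 1..G. real (card {a \<in> A. m dvd a})) \<le> M * real G powr (3 / real l) * real (card A)"
proof -
  obtain k where l: "l = Suc k" using assms by (cases l) auto
  obtain C where C: "C \<ge> 1" "\<And>X G::nat. G \<ge> 1 \<Longrightarrow>
      (\<Sum>a = 1..X. real (card {d \<in> {1..G}. d dvd a}) ^ l) \<le> C * real X * real G ^ 2"
    using small_divisor_moment_bound[OF assms] by blast
  show ?thesis
  proof (intro exI[of _ "2 * C"] conjI allI impI)
    show "2 * C \<ge> 1" using C(1) by simp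
  next
    fix X G :: nat and A
    assume A: "A \<subseteq> {1..X}" and "G \<ge> 1" and X: "X \<le> G * card A"
    have finA: "finite A" using A finite_subset by blast
    define f where "f a = real (card {d \<in> {1..G}. d dvd a})" for a
    define T where "T = C * real G powr (3 / real l)"
    have "T > 0" using C(1) \<open>G \<ge> 1\<close> by (simp add: T_def)
    have "T ^ l = C ^ l * (real G powr (3 / real l)) powr real l"
      using \<open>G \<ge> 1\<close> by (simp add: T_def power_mult_distrib powr_realpow)
    also have "\<dots> = C ^ l * real G ^ 3"
      using \<open>G \<ge> 1\<close> assms by (simp add: powr_powr)
    also have "\<dots> \<ge> C * real G ^ 3"
      using C(1) assms by (intro mult_right_mono self_le_power) auto
    finally have T_l: "C * real G ^ 3 \<le> T ^ l" .
    have split: "T ^ k * y \<le> T ^ l + y ^ l" if "y \<ge> 0" for y :: real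
    proof (cases "y \<le> T")
      case True
      then have "T ^ k * y \<le> T ^ k * T" using \<open>T > 0\<close> by (intro mult_left_mono) auto
      moreover have "T ^ k * T = T ^ l" by (simp add: l mult.commute)
      ultimately show ?thesis using zero_le_power[OF that, of l] by linarith
    next
      case False
      then have "T ^ k * y \<le> y ^ k * y"
        using \<open>T > 0\<close> by (intro mult_right_mono power_mono) auto
      then show ?thesis using \<open>T > 0\<close> by (simp add: l mult.commute add_increasing)
    qed
    have "T ^ k * (\<Sum>a\<in>A. f a) \<le> (\<Sum>a\<in>A. T ^ l + f a ^ l)"
      unfolding sum_distrib_left by (intro sum_mono split) (simp add: f_def)
    also have "\<dots> = real (card A) * T ^ l + (\<Sum>a\<in>A. f a ^ l)" by (simp add: sum.distrib)
    also have "(\<Sum>a\<in>A. f a ^ l) \<le> (\<Sum>a = 1..X. f a ^ l)"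
      using A by (intro sum_mono2) (auto simp: f_def)
    also have "\<dots> \<le> C * real X * real G ^ 2" using C(2)[OF \<open>G \<ge> 1\<close>] by (simp add: f_def)
    also have "\<dots> \<le> C * (real G * real (card A)) * real G ^ 2"
      using X C(1) by (intro mult_right_mono mult_left_mono) (auto simp flip: of_nat_mult)
    also have "\<dots> = C * real G ^ 3 * real (card A)"
      by (simp add: power2_eq_square power3_eq_cube)
    also have "\<dots> \<le> T ^ l * real (card A)" using T_l by (intro mult_right_mono) auto
    finally have "T ^ k * (\<Sum>a\<in>A. f a) \<le> T ^ k * (2 * T * real (card A))"
      by (simp add: l algebra_simps)
    then have "(\<Sum>a\<in>A. f a) \<le> 2 * T * real (card A)" using \<open>T > 0\<close> by simp
    moreover have "(\<Sum>m = 1..G. real (card {a \<in> A. m dvd a})) = (\<Sum>a\<in>A. f a)"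
    proof -
      have "(\<Sum>m = 1..G. \<Sum>a | a \<in> A \<and> m dvd a. 1::real)
          = (\<Sum>a\<in>A. \<Sum>m | m \<in> {1..G} \<and> m dvd a. 1)"
        using finA by (intro sum.swap_restrict) auto
      then show ?thesis by (simp add: f_def)
    qed
    ultimately show "(\<Sum>m = 1..G. real (card {a \<in> A. m dvd a}))
        \<le> 2 * C * real G powr (3 / real l) * real (card A)"
      by (simp add: T_def mult_ac)
  qed
qed

section \<open>Pairs with a given greatest common divisor\<close>

lemma sum_inverse_squares_tail_le:
  fixes G N :: nat
  assumes "G \<ge> 1"
  shows "(\<Sum>m\<in>{G<..N}. 1 / real m ^ 2) \<le> 1 / real G"
proof (cases "G \<le> N")
  case True
  have "(\<Sum>m\<in>{G<..N}. 1 / real m ^ 2) \<le> 1 / real G - 1 / real N"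
    using True
  proof (induction N rule: dec_induct)
    case (step n)
    have "n > 0" using assms step by simp
    have "{G<..Suc n} = insert (Suc n) {G<..n}" using step by auto
    then have "(\<Sum>m\<in>{G<..Suc n}. 1 / real m ^ 2)
        \<le> 1 / real (Suc n) ^ 2 + (1 / real G - 1 / real n)"
      using step.IH by simp
    also have "1 / real (Suc n) ^ 2 \<le> 1 / (real n * real (Suc n))"
      unfolding power2_eq_square using \<open>n > 0\<close> by (intro divide_left_mono mult_right_mono) auto
    also have "\<dots> = 1 / real n - 1 / real (Suc n)" using \<open>n > 0\<close> by (simp add: field_simps)
    finally show ?case by simp
  qed simp
  then show ?thesis by (smt (verit) divide_nonneg_nonneg of_nat_0_le_iff)
qed simp

lemma card_pairs_large_gcd_le:
  fixes X Y G :: nat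
  assumes "G \<ge> 1"
  shows "real (card {(a, b). a \<in> {1..X} \<and> b \<in> {1..Y} \<and> gcd a b > G}) \<le> real X * real Y / real G"
proof -
  have "{(a, b). a \<in> {1..X} \<and> b \<in> {1..Y} \<and> gcd a b > G}
      \<subseteq> (\<Union>m\<in>{G<..X}. {a \<in> {1..X}. m dvd a} \<times> {b \<in> {1..Y}. m dvd b})"
  proof clarify
    fix a b assume ab: "a \<in> {1..X}" "b \<in> {1..Y}" "gcd a b > G"
    have "gcd a b \<le> a" using ab by (intro dvd_imp_le) auto
    then show "(a, b) \<in> (\<Union>m\<in>{G<..X}. {a \<in> {1..X}. m dvd a} \<times> {b \<in> {1..Y}. m dvd b})"
      using ab by (intro UN_I[of "gcd a b"]) auto
  qed
  then have "card {(a, b). a \<in> {1..X} \<and> b \<in> {1..Y} \<and> gcd a b > G}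
      \<le> (\<Sum>m\<in>{G<..X}. card ({a \<in> {1..X}. m dvd a} \<times> {b \<in> {1..Y}. m dvd b}))"
    by (intro order_trans[OF card_mono card_UN_le]) auto
  then have "real (card {(a, b). a \<in> {1..X} \<and> b \<in> {1..Y} \<and> gcd a b > G})
      \<le> (\<Sum>m\<in>{G<..X}. real (card {a \<in> {1..X}. m dvd a}) * real (card {b \<in> {1..Y}. m dvd b}))"
    unfolding card_cartesian_product by (metis (mono_tags, lifting) of_nat_le_iff of_nat_mult of_nat_sum sum.cong)
  also have "\<dots> \<le> (\<Sum>m\<in>{G<..X}. (real X / real m) * (real Y / real m))"
    by (intro sum_mono mult_mono card_multiples_le) auto
  also have "\<dots> = real X * real Y * (\<Sum>m\<in>{G<..X}. 1 / real m ^ 2)"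
    by (simp add: sum_distrib_left power2_eq_square)
  also have "\<dots> \<le> real X * real Y * (1 / real G)"
    by (intro mult_left_mono sum_inverse_squares_tail_le assms) auto
  finally show ?thesis by simp
qed

definition pairs_with_gcd :: "nat set \<Rightarrow> nat set \<Rightarrow> nat \<Rightarrow> (nat \<times> nat) set" where
  "pairs_with_gcd A B m = {(a, b). a \<in> A \<and> b \<in> B \<and> gcd a b = m}"

text \<open>
  Let \<open>G\<close> be about \<open>4 / \<gamma>\<close>. Few pairs have a greatest common divisor above \<open>G\<close>, so the
  classes \<open>P m\<close> with \<open>m \<le> G\<close> cover three quarters of \<open>A \<times> B\<close>. If \<open>u m\<close> and \<open>v m\<close> are the proportions
  of multiples of \<open>m\<close> in \<open>A\<close> and in \<open>B\<close>, then \<open>P m\<close> has relative size at most \<open>u m * v m\<close>, and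
  \<open>\<Sum>u\<close>, \<open>\<Sum>v\<close> are at most \<open>R\<close>, a small power of \<open>G\<close>. If each class had relative size below
  \<open>1 / (4 * R\<^sup>2)\<close>, the geometric mean of the two bounds would be at most \<open>(u m + v m) / (4 * R)\<close>,
  and the classes would cover at most half of \<open>A \<times> B\<close>.

  The trivial bound \<open>u m * v m \<le> 1\<close> for each of the \<open>G\<close> classes would cost a factor \<open>G\<close> instead of
  \<open>R\<^sup>2\<close>, and hence give an exponent 2 instead of \<open>1 + \<epsilon>\<close>.
\<close>
lemma exists_large_gcd_class:
  fixes \<epsilon> :: real
  assumes "\<epsilon> > 0"
  shows "\<exists>c>0. \<forall>(X::nat) (Y::nat) A B \<gamma>. A \<subseteq> {1..X} \<longrightarrow> B \<subseteq> {1..Y} \<longrightarrow> X > 0 \<longrightarrow> Y > 0 \<longrightarrow>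
    0 < \<gamma> \<longrightarrow> \<gamma> * real X * real Y \<le> real (card A) * real (card B) \<longrightarrow>
    (\<exists>m>0. c * real X * real Y * \<gamma> powr (1 + \<epsilon>)
      \<le> real (card (pairs_with_gcd A B m)))"
proof -
  \<comment> \<open>The loss \<open>R\<^sup>2\<close> has order \<open>G powr (6 / l)\<close>, which must not exceed \<open>G powr \<epsilon>\<close>.\<close>
  obtain l :: nat where l: "6 / \<epsilon> < real l" using reals_Archimedean2 by blast
  then have l0: "real l > 0" using assms by (meson divide_pos_pos less_trans zero_less_numeral)
  then have "l \<ge> 1" by simp
  have l_eps: "6 / real l \<le> \<epsilon>" using l l0 assms by (simp add: field_simps)
  obtain M where M: "M \<ge> 1" "\<And>(X::nat) (G::nat) A. A \<subseteq> {1..X} \<Longrightarrow> G \<ge> 1 \<Longrightarrow> X \<le> G * card A \<Longrightarrow>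
      (\<Sum>m = 1..G. real (card {a \<in> A. m dvd a})) \<le> M * real G powr (3 / real l) * real (card A)"
    using sum_card_multiples_le[OF \<open>l \<ge> 1\<close>] by blast
  define c where "c = 1 / (4 * M ^ 2 * 5 powr \<epsilon>)"
  show ?thesis
  proof (intro exI[of _ c] conjI allI impI)
    show "c > 0" using M(1) by (simp add: c_def)
  next
    fix X Y :: nat and A B and \<gamma> :: real
    assume A: "A \<subseteq> {1..X}" and B: "B \<subseteq> {1..Y}" and XY: "X > 0" "Y > 0" and "0 < \<gamma>"
      and \<gamma>: "\<gamma> * real X * real Y \<le> real (card A) * real (card B)"
    have fin: "finite A" "finite B" using A B finite_subset by blast+
    have cardA: "card A \<le> X" using card_mono[OF _ A] by simp
    have cardB: "card B \<le> Y" using card_mono[OF _ B] by simp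
    have "\<gamma> * real X * real Y > 0" using XY \<open>0 < \<gamma>\<close> by simp
    then have AB: "real (card A) * real (card B) > 0" using \<gamma> by linarith
    then have posA: "card A > 0" and posB: "card B > 0" by (auto intro: gr0I)
    have "\<gamma> * (real X * real Y) \<le> 1 * (real X * real Y)"
      using \<gamma> mult_mono[of "real (card A)" "real X" "real (card B)" "real Y"] cardA cardB
      by (simp add: mult.assoc)
    then have "\<gamma> \<le> 1" using XY by (simp add: mult_le_cancel_right)
    define G where "G = nat \<lceil>4 / \<gamma>\<rceil>"
    have G4: "4 / \<gamma> \<le> real G" unfolding G_def by linarith
    moreover have "4 / \<gamma> \<ge> 4" using \<open>0 < \<gamma>\<close> \<open>\<gamma> \<le> 1\<close> by (simp add: field_simps)
    ultimately have "G \<ge> 1" by simp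
    have "real G \<le> 4 / \<gamma> + 1" unfolding G_def using \<open>4 / \<gamma> \<ge> 4\<close> by linarith
    also have "\<dots> \<le> 5 / \<gamma>" using \<open>0 < \<gamma>\<close> \<open>\<gamma> \<le> 1\<close> by (simp add: field_simps)
    finally have G5: "real G \<le> 5 / \<gamma>" .
    have "1 \<le> real G * \<gamma>" using G4 \<open>0 < \<gamma>\<close> by (simp add: field_simps)
    have XA: "X \<le> G * card A"
    proof -
      have "real X * real Y \<le> real G * \<gamma> * (real X * real Y)"
        using mult_right_mono[OF \<open>1 \<le> real G * \<gamma>\<close>, of "real X * real Y"] by simp
      also have "\<dots> \<le> real G * (real (card A) * real (card B))"
        using mult_left_mono[OF \<gamma>, of "real G"] by (simp add: mult_ac)
      also have "\<dots> \<le> real G * (real (card A) * real Y)"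
        using cardB by (intro mult_left_mono) auto
      finally have "real X \<le> real (G * card A)" using XY by simp
      then show ?thesis by linarith
    qed
    have YB: "Y \<le> G * card B"
    proof -
      have "real X * real Y \<le> real G * \<gamma> * (real X * real Y)"
        using mult_right_mono[OF \<open>1 \<le> real G * \<gamma>\<close>, of "real X * real Y"] by simp
      also have "\<dots> \<le> real G * (real (card A) * real (card B))"
        using mult_left_mono[OF \<gamma>, of "real G"] by (simp add: mult_ac)
      also have "\<dots> \<le> real G * (real X * real (card B))"
        using cardA by (intro mult_left_mono mult_right_mono) auto
      finally have "real Y \<le> real (G * card B)" using XY by simp
      then show ?thesis by linarith
    qed
    define P where "P = pairs_with_gcd A B"
    define R where "R = M * real G powr (3 / real l)"
    have "R > 0" using M(1) \<open>G \<ge> 1\<close> by (simp add: R_def)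
    define u where "u m = real (card {a \<in> A. m dvd a}) / real (card A)" for m
    define v where "v m = real (card {b \<in> B. m dvd b}) / real (card B)" for m
    have sum_u: "(\<Sum>m = 1..G. u m) \<le> R"
      using M(2)[OF A \<open>G \<ge> 1\<close> XA] posA
      by (simp add: u_def R_def divide_le_eq flip: sum_divide_distrib)
    have sum_v: "(\<Sum>m = 1..G. v m) \<le> R"
      using M(2)[OF B \<open>G \<ge> 1\<close> YB] posB
      by (simp add: v_def R_def divide_le_eq flip: sum_divide_distrib)
    have finP: "finite (P m)" for m
      by (rule finite_subset[of _ "A \<times> B"]) (use fin in \<open>auto simp: P_def pairs_with_gcd_def\<close>)
    have P_le: "real (card (P m)) \<le> real (card A) * real (card B) * (u m * v m)" for m
    proof -
      have "P m \<subseteq> {a \<in> A. m dvd a} \<times> {b \<in> B. m dvd b}" by (auto simp: P_def pairs_with_gcd_def)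
      then have "card (P m) \<le> card ({a \<in> A. m dvd a} \<times> {b \<in> B. m dvd b})"
        using fin by (intro card_mono) auto
      then have "real (card (P m)) \<le> real (card {a \<in> A. m dvd a}) * real (card {b \<in> B. m dvd b})"
        unfolding card_cartesian_product by (metis of_nat_le_iff of_nat_mult)
      also have "\<dots> = real (card A) * real (card B) * (u m * v m)"
        using posA posB by (simp add: u_def v_def)
      finally show ?thesis .
    qed
    have total: "3 / 4 * (real (card A) * real (card B)) \<le> (\<Sum>m = 1..G. real (card (P m)))"
    proof -
      define L where "L = {(a, b). a \<in> {1..X} \<and> b \<in> {1..Y} \<and> gcd a b > G}"
      have "A \<times> B \<subseteq> L \<union> (\<Union>m\<in>{1..G}. P m)"
      proof clarify
        fix a b assume ab: "a \<in> A" "b \<in> B" "(a, b) \<notin> (\<Union>m\<in>{1..G}. P m)"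
        have "gcd a b \<ge> 1" using ab A by (auto simp: Suc_le_eq)
        then show "(a, b) \<in> L" using ab A B by (force simp: L_def P_def pairs_with_gcd_def)
      qed
      moreover have "finite L"
        by (rule finite_subset[of _ "{1..X} \<times> {1..Y}"]) (auto simp: L_def)
      ultimately have "card (A \<times> B) \<le> card (L \<union> (\<Union>m\<in>{1..G}. P m))"
        using finP by (intro card_mono) auto
      also have "\<dots> \<le> card L + (\<Sum>m = 1..G. card (P m))"
        by (intro order_trans[OF card_Un_le] add_left_mono card_UN_le) auto
      finally have "real (card A * card B) \<le> real (card L + (\<Sum>m = 1..G. card (P m)))"
        by (simp only: card_cartesian_product of_nat_le_iff)
      moreover have "real (card L) \<le> real (card A) * real (card B) / 4"
      proof -
        have "real (card L) \<le> real X * real Y / real G"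
          unfolding L_def by (rule card_pairs_large_gcd_le[OF \<open>G \<ge> 1\<close>])
        also have "\<dots> \<le> real X * real Y / (4 / \<gamma>)"
          using G4 \<open>0 < \<gamma>\<close> \<open>G \<ge> 1\<close> by (intro divide_left_mono) auto
        also have "\<dots> \<le> real (card A) * real (card B) / 4" using \<gamma> by (simp add: mult_ac)
        finally show ?thesis .
      qed
      ultimately show ?thesis by simp
    qed
    have "\<exists>m\<in>{1..G}. real (card A) * real (card B) / (4 * R ^ 2) \<le> real (card (P m))"
    proof (rule ccontr)
      assume "\<not> ?thesis"
      then have small: "real (card (P m)) \<le> real (card A) * real (card B) / (4 * R ^ 2)"
        if "m \<in> {1..G}" for m
        using that by force
      have "real (card (P m)) \<le> real (card A) * real (card B) / (4 * R) * (u m + v m)"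
        if "m \<in> {1..G}" for m
      proof (rule power2_le_imp_le)
        have "real (card (P m)) ^ 2
            \<le> (real (card A) * real (card B) / (4 * R ^ 2)) * (real (card A) * real (card B) * (u m * v m))"
          unfolding power2_eq_square using small[OF that] P_le[of m]
          by (intro mult_mono) (auto simp: power2_eq_square)
        also have "\<dots> = (real (card A) * real (card B) / (4 * R)) ^ 2 * (4 * u m * v m)"
          by (simp add: power2_eq_square field_simps)
        also have "\<dots> \<le> (real (card A) * real (card B) / (4 * R)) ^ 2 * (u m + v m) ^ 2"
        proof (intro mult_left_mono)
          have "(u m + v m) ^ 2 - 4 * u m * v m = (u m - v m) ^ 2"
            by (simp add: power2_eq_square algebra_simps)
          then show "4 * u m * v m \<le> (u m + v m) ^ 2" by (smt (verit) zero_le_power2)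
        qed auto
        finally show "real (card (P m)) ^ 2
            \<le> (real (card A) * real (card B) / (4 * R) * (u m + v m)) ^ 2"
          by (simp only: power_mult_distrib)
      qed (use \<open>R > 0\<close> in \<open>auto simp: u_def v_def\<close>)
      then have "(\<Sum>m = 1..G. real (card (P m)))
          \<le> (\<Sum>m = 1..G. real (card A) * real (card B) / (4 * R) * (u m + v m))"
        by (intro sum_mono) auto
      also have "\<dots> = real (card A) * real (card B) / (4 * R) * ((\<Sum>m = 1..G. u m) + (\<Sum>m = 1..G. v m))"
        by (simp only: flip: sum.distrib sum_distrib_left)
      also have "\<dots> \<le> real (card A) * real (card B) / (4 * R) * (R + R)"
        using sum_u sum_v \<open>R > 0\<close> by (intro mult_left_mono add_mono) auto
      also have "\<dots> = real (card A) * real (card B) / 2" using \<open>R > 0\<close> by simp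
      finally show False using total AB by linarith
    qed
    then obtain m where m: "m \<in> {1..G}"
        "real (card A) * real (card B) / (4 * R ^ 2) \<le> real (card (P m))"
      by blast
    have "R ^ 2 = M ^ 2 * real G powr (6 / real l)"
      using \<open>G \<ge> 1\<close> by (simp add: R_def power_mult_distrib power2_eq_square flip: powr_add)
    also have "\<dots> \<le> M ^ 2 * real G powr \<epsilon>"
      using \<open>G \<ge> 1\<close> l_eps by (intro mult_left_mono powr_mono) auto
    also have "\<dots> \<le> M ^ 2 * (5 / \<gamma>) powr \<epsilon>"
      using G5 assms by (intro mult_left_mono powr_mono2) auto
    also have "\<dots> = M ^ 2 * 5 powr \<epsilon> / \<gamma> powr \<epsilon>"
      using \<open>0 < \<gamma>\<close> by (simp add: powr_divide)
    finally have R2: "R ^ 2 \<le> M ^ 2 * 5 powr \<epsilon> / \<gamma> powr \<epsilon>" .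
    have "c * real X * real Y * \<gamma> powr (1 + \<epsilon>)
        = (\<gamma> * real X * real Y) / (4 * (M ^ 2 * 5 powr \<epsilon> / \<gamma> powr \<epsilon>))"
      using \<open>0 < \<gamma>\<close> by (simp add: c_def powr_add mult_ac)
    also have "\<dots> \<le> (real (card A) * real (card B)) / (4 * R ^ 2)"
      using \<gamma> R2 \<open>R > 0\<close> AB by (intro frac_le) auto
    also note m(2)
    finally show "\<exists>m>0. c * real X * real Y * \<gamma> powr (1 + \<epsilon>)
        \<le> real (card (pairs_with_gcd A B m))"
      using m(1) by (intro exI[of _ m]) (auto simp: P_def)
  qed
qed

section \<open>Points with distinct slopes span a small triangle\<close>

text \<open>
  A pair \<open>(a, b)\<close> is viewed as a point of the plane; two of them are collinear with the origin
  exactly if the determinant \<open>a' * b - a * b'\<close> vanishes.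
\<close>
definition distinct_slopes :: "(nat \<times> nat) set \<Rightarrow> bool" where
  "distinct_slopes S \<longleftrightarrow>
     (\<forall>(a, b)\<in>S. \<forall>(a', b')\<in>S. a * b' = a' * b \<longrightarrow> a = a' \<and> b = b')"

text \<open>
  All points on one line through the origin are multiples of one primitive point, and the factor is
  the greatest common divisor of the coordinates.
\<close>
lemma distinct_slopes_fixed_gcd:
  assumes "m > 0" and "\<And>a b. (a, b) \<in> S \<Longrightarrow> gcd a b = m \<and> a > 0"
  shows "distinct_slopes S"
  unfolding distinct_slopes_def
proof clarify
  fix a b a' b' assume *: "(a, b) \<in> S" "(a', b') \<in> S" "a * b' = a' * b"
  have "a * m = a * gcd a' b'" using assms(2)[OF *(2)] by simp
  also have "\<dots> = gcd (a * a') (a * b')" by (simp add: gcd_mult_distrib_nat)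
  also have "\<dots> = a' * gcd a b" using *(3) by (simp add: gcd_mult_distrib_nat mult.commute)
  also have "\<dots> = a' * m" using assms(2)[OF *(1)] by simp
  finally have "a = a'" using assms(1) by simp
  then show "a = a' \<and> b = b'" using * assms(2) by auto
qed

text \<open>
  The points lie in the half of the rectangle where the slope \<open>a / b\<close> is at most \<open>X / Y\<close>. Cutting
  the interval \<open>(0, X / Y]\<close> of slopes into \<open>card S - 1\<close> equal parts, two points fall into the same
  part, and \<open>a' * b - a * b' = (a' / b' - a / b) * b * b'\<close> with \<open>b, b' \<le> Y\<close>.
\<close>
lemma small_determinant_below_diagonal:
  fixes X Y :: nat
  assumes S: "S \<subseteq> {1..X} \<times> {1..Y}" and below: "\<And>a b. (a, b) \<in> S \<Longrightarrow> a * Y \<le> b * X"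
    and slopes: "distinct_slopes S" and card: "card S \<ge> 2"
  shows "\<exists>a b a' b'. (a, b) \<in> S \<and> (a', b') \<in> S \<and> a * b' < a' * b \<and>
    real (a' * b) - real (a * b') \<le> real X * real Y / real (card S - 1)"
proof -
  define N where "N = card S - 1"
  have N: "N > 0" using card by (simp add: N_def)
  define t where "t = (\<lambda>(a, b). real a * real Y * real N / (real b * real X))"
  define f where "f p = \<lceil>t p\<rceil>" for p
  have pos: "a > 0" "a \<le> X" "b > 0" "b \<le> Y" "X > 0" "Y > 0" if "(a, b) \<in> S" for a b
    using that S by auto
  have "f ` S \<subseteq> {1..int N}"
  proof clarify
    fix a b assume ab: "(a, b) \<in> S"
    have "t (a, b) > 0" using pos[OF ab] N by (simp add: t_def)
    moreover have "t (a, b) \<le> real N"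
    proof -
      have "real a * real Y \<le> real b * real X"
        using below[OF ab] by (metis of_nat_le_iff of_nat_mult)
      then have "real N * (real a * real Y) \<le> real N * (real b * real X)"
        by (intro mult_left_mono) auto
      then show ?thesis using pos[OF ab] by (simp add: t_def divide_le_eq mult_ac)
    qed
    ultimately show "f (a, b) \<in> {1..int N}" by (auto simp: f_def ceiling_le_iff)
  qed
  then have "card (f ` S) \<le> N" using card_mono[of "{1..int N}" "f ` S"] by simp
  then have "card (f ` S) < card S" using N by (simp add: N_def)
  then have "\<not> inj_on f S" by (rule pigeonhole)
  then obtain a b a' b' where ab: "(a, b) \<in> S" "(a', b') \<in> S" "(a, b) \<noteq> (a', b')"
      "f (a, b) = f (a', b')"
    by (auto simp: inj_on_def)
  have "\<bar>t (a', b') - t (a, b)\<bar> \<le> 1" using ab(4) unfolding f_def by linarith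
  moreover have "t (a', b') - t (a, b)
      = (real (a' * b) - real (a * b')) * (real Y * real N / (real b * real b' * real X))"
    using pos[OF ab(1)] pos[OF ab(2)] by (simp add: t_def field_simps)
  ultimately have "\<bar>real (a' * b) - real (a * b')\<bar> * (real Y * real N / (real b * real b' * real X)) \<le> 1"
    by (simp add: abs_mult)
  then have "\<bar>real (a' * b) - real (a * b')\<bar> \<le> real b * real b' * real X / (real Y * real N)"
    using pos[OF ab(1)] pos[OF ab(2)] N by (simp add: field_simps)
  also have "\<dots> \<le> real Y * real Y * real X / (real Y * real N)"
    using pos[OF ab(1)] pos[OF ab(2)] by (intro divide_right_mono mult_right_mono mult_mono) auto
  also have "\<dots> = real X * real Y / real N" using pos[OF ab(1)] by simp
  finally have le: "\<bar>real (a' * b) - real (a * b')\<bar> \<le> real X * real Y / real (card S - 1)"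
    by (simp add: N_def)
  have "a * b' \<noteq> a' * b" using slopes ab by (auto simp: distinct_slopes_def)
  then consider "a * b' < a' * b" | "a' * b < a * b'" by linarith
  then show ?thesis
  proof cases
    case 1
    then show ?thesis using le ab by (meson abs_le_D1)
  next
    case 2
    moreover have "real (a * b') - real (a' * b) \<le> real X * real Y / real (card S - 1)"
      using le by (metis abs_le_D2 minus_diff_eq)
    ultimately show ?thesis using ab by blast
  qed
qed

text \<open>
  The diagonal of the rectangle cuts it into two halves that are exchanged by swapping coordinates;
  one of them contains at least half of the points. The factor 4 allows for this and for the difference
  between \<open>n - 1\<close> and \<open>n\<close>.
\<close>
lemma small_determinant:
  fixes X Y :: nat
  assumes S: "S \<subseteq> {1..X} \<times> {1..Y}" and slopes: "distinct_slopes S" and card: "card S \<ge> 4"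
  shows "\<exists>a b a' b'. (a, b) \<in> S \<and> (a', b') \<in> S \<and> a * b' < a' * b \<and>
    real (a' * b) - real (a * b') \<le> 4 * real X * real Y / real (card S)"
proof -
  have finS: "finite S" using card by (intro card_ge_0_finite) simp
  have bound: "real X * real Y / real (n - 1) \<le> 4 * real X * real Y / real (card S)"
    if "2 * n \<ge> card S" for n
  proof -
    have "real (card S) \<le> 4 * real (n - 1)" using that card by linarith
    then have "real X * real Y * real (card S) \<le> real X * real Y * (4 * real (n - 1))"
      by (intro mult_left_mono) auto
    then show ?thesis using that card by (simp add: divide_simps mult_ac)
  qed
  define U where "U = {(a, b) \<in> S. a * Y \<le> b * X}"
  define V where "V = (\<lambda>(a, b). (b, a)) ` (S - U)"
  have "U \<subseteq> S" by (auto simp: U_def)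
  have "card (S - U) = card S - card U"
    using \<open>U \<subseteq> S\<close> finS by (simp add: card_Diff_subset finite_subset)
  moreover have cardV: "card V = card (S - U)"
    unfolding V_def by (intro card_image) (auto simp: inj_on_def)
  ultimately consider "2 * card U \<ge> card S" | "2 * card V \<ge> card S" by linarith
  then show ?thesis
  proof cases
    case 1
    have "\<exists>a b a' b'. (a, b) \<in> U \<and> (a', b') \<in> U \<and> a * b' < a' * b \<and>
        real (a' * b) - real (a * b') \<le> real X * real Y / real (card U - 1)"
    proof (rule small_determinant_below_diagonal)
      show "distinct_slopes U" using slopes \<open>U \<subseteq> S\<close> unfolding distinct_slopes_def by blast
    qed (use 1 card S in \<open>auto simp: U_def\<close>)
    then show ?thesis using \<open>U \<subseteq> S\<close> bound[OF 1] by (meson order_trans subsetD)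
  next
    case 2
    have "\<exists>b a b' a'. (b, a) \<in> V \<and> (b', a') \<in> V \<and> b * a' < b' * a \<and>
        real (b' * a) - real (b * a') \<le> real Y * real X / real (card V - 1)"
    proof (rule small_determinant_below_diagonal)
      show "V \<subseteq> {1..Y} \<times> {1..X}" using S by (auto simp: V_def)
      show "distinct_slopes V"
        using slopes unfolding distinct_slopes_def V_def
        by (fastforce simp: mult.commute)
    qed (use 2 card in \<open>auto simp: V_def U_def mult.commute\<close>)
    then obtain a b a' b' where "(b, a) \<in> V" "(b', a') \<in> V" and lt: "b * a' < b' * a"
        and le: "real (b' * a) - real (b * a') \<le> real Y * real X / real (card V - 1)"
      by blast
    then have "(a, b) \<in> S" "(a', b') \<in> S" by (auto simp: V_def)
    moreover have "real (a * b') - real (a' * b) \<le> 4 * real X * real Y / real (card S)"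
      using le bound[OF 2] by (simp add: mult.commute)
    moreover have "a' * b < a * b'" using lt by (simp add: mult.commute)
    ultimately show ?thesis by blast
  qed
qed

section \<open>Small gaps in products of finite and infinite sets\<close>

text \<open>
  In a class of pairs with the same greatest common divisor the slopes are distinct, and the
  determinant of two points of \<open>A \<times> B\<close> is a difference of two elements of the product set. The lower
  bound on \<open>X * Y\<close> provides the four points that the pigeonhole argument needs.
\<close>
lemma finite_small_product_gap:
  fixes \<epsilon> :: real
  assumes "\<epsilon> > 0"
  shows "\<exists>K>0. \<forall>(X::nat) (Y::nat) A B \<gamma>. A \<subseteq> {1..X} \<longrightarrow> B \<subseteq> {1..Y} \<longrightarrow> 0 < \<gamma> \<longrightarrow>
    \<gamma> * real X * real Y \<le> real (card A) * real (card B) \<longrightarrow>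
    K \<le> real X * real Y * \<gamma> powr (1 + \<epsilon>) \<longrightarrow>
    (\<exists>a\<in>A. \<exists>b\<in>B. \<exists>a'\<in>A. \<exists>b'\<in>B. a * b' < a' * b \<and>
      real (a' * b) - real (a * b') \<le> K / \<gamma> powr (1 + \<epsilon>))"
proof -
  obtain c where c: "c > 0" "\<And>(X::nat) (Y::nat) A B \<gamma>. A \<subseteq> {1..X} \<Longrightarrow> B \<subseteq> {1..Y} \<Longrightarrow>
      X > 0 \<Longrightarrow> Y > 0 \<Longrightarrow> 0 < \<gamma> \<Longrightarrow> \<gamma> * real X * real Y \<le> real (card A) * real (card B) \<Longrightarrow>
      \<exists>m>0. c * real X * real Y * \<gamma> powr (1 + \<epsilon>)
        \<le> real (card (pairs_with_gcd A B m))"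
    using exists_large_gcd_class[OF assms] by blast
  show ?thesis
  proof (intro exI[of _ "4 / c"] conjI allI impI)
    show "4 / c > 0" using c(1) by simp
  next
    fix X Y :: nat and A B and \<gamma> :: real
    assume A: "A \<subseteq> {1..X}" and B: "B \<subseteq> {1..Y}" and "0 < \<gamma>"
      and \<gamma>: "\<gamma> * real X * real Y \<le> real (card A) * real (card B)"
      and large: "4 / c \<le> real X * real Y * \<gamma> powr (1 + \<epsilon>)"
    have "0 < 4 / c" using c(1) by simp
    then have "0 < real X * real Y * \<gamma> powr (1 + \<epsilon>)" using large by linarith
    then have XY: "X > 0" "Y > 0" by (auto intro: gr0I)
    obtain m where "m > 0" and m: "c * real X * real Y * \<gamma> powr (1 + \<epsilon>)
        \<le> real (card (pairs_with_gcd A B m))"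
      using c(2)[OF A B XY \<open>0 < \<gamma>\<close> \<gamma>] by blast
    define S where "S = pairs_with_gcd A B m"
    have S: "S \<subseteq> {1..X} \<times> {1..Y}" using A B by (auto simp: S_def pairs_with_gcd_def)
    have cS: "c * (real X * real Y * \<gamma> powr (1 + \<epsilon>)) \<le> real (card S)"
      using m by (simp add: S_def mult_ac)
    have "4 \<le> c * (real X * real Y * \<gamma> powr (1 + \<epsilon>))"
      using large c(1) by (simp add: field_simps)
    then have "card S \<ge> 4" using cS by linarith
    moreover have "distinct_slopes S"
      using S by (intro distinct_slopes_fixed_gcd[OF \<open>m > 0\<close>]) (auto simp: S_def pairs_with_gcd_def)
    ultimately obtain a b a' b' where ab: "(a, b) \<in> S" "(a', b') \<in> S" "a * b' < a' * b"
        "real (a' * b) - real (a * b') \<le> 4 * real X * real Y / real (card S)"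
      using small_determinant[OF S] by blast
    have "4 * real X * real Y / real (card S)
        \<le> 4 * real X * real Y / (c * (real X * real Y * \<gamma> powr (1 + \<epsilon>)))"
      using cS \<open>card S \<ge> 4\<close> c(1) XY \<open>0 < \<gamma>\<close> by (intro divide_left_mono) auto
    also have "\<dots> = 4 / c / \<gamma> powr (1 + \<epsilon>)" using XY by (simp add: field_simps)
    finally have "real (a' * b) - real (a * b') \<le> 4 / c / \<gamma> powr (1 + \<epsilon>)"
      using ab(4) by linarith
    then show "\<exists>a\<in>A. \<exists>b\<in>B. \<exists>a'\<in>A. \<exists>b'\<in>B. a * b' < a' * b \<and>
        real (a' * b) - real (a * b') \<le> 4 / c / \<gamma> powr (1 + \<epsilon>)"
      using ab(1-3) unfolding S_def pairs_with_gcd_def by blast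
  qed
qed

text \<open>
  Arbitrarily far out more than half of the upper density is attained on \<open>[1, x]\<close>. Rounding \<open>x\<close> down
  to an integer loses no terms, and dropping the terms up to a fixed \<open>Z\<close> costs at most a quarter of
  the upper density when \<open>x\<close> is large.
\<close>
lemma upper_density_dense_window:
  fixes Z :: nat
  assumes "upper_density A = ereal \<alpha>" "\<alpha> > 0"
  shows "\<exists>X\<ge>N. \<alpha> / 4 * real X \<le> real (card {a \<in> A. int Z < a \<and> a \<le> int X})"
proof -
  define f where "f x = real (card {a \<in> A. 1 \<le> a \<and> real_of_int a \<le> x})" for x
  \<comment> \<open>The first bound ensures \<open>X \<ge> N\<close>, the second one that the \<open>Z\<close> dropped terms are at most
    \<open>\<alpha> / 4 * x\<close>.\<close>
  define x0 where "x0 = max (real N + 1) (4 * real Z / \<alpha>)"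
  have "\<exists>x\<ge>x0. f x / x > \<alpha> / 2"
  proof (rule ccontr)
    assume "\<not> ?thesis"
    then have "\<forall>\<^sub>F x in at_top. ereal (f x / x) \<le> ereal (\<alpha> / 2)"
      unfolding eventually_at_top_linorder by (intro exI[of _ x0]) (auto simp: not_less)
    then have "upper_density A \<le> ereal (\<alpha> / 2)"
      unfolding upper_density_def f_def by (rule Limsup_bounded)
    then show False using assms by simp
  qed
  then obtain x where x: "x \<ge> x0" "f x / x > \<alpha> / 2" by blast
  have "x > 0" using x(1) by (simp add: x0_def)
  define X where "X = nat \<lfloor>x\<rfloor>"
  have Xx: "real X \<le> x" "x < real X + 1" using \<open>x > 0\<close> by (auto simp: X_def)
  have "real_of_int a \<le> x \<longleftrightarrow> a \<le> int X" for a
    using \<open>x > 0\<close> by (simp add: X_def le_floor_iff)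
  then have f: "f x = real (card {a \<in> A. 1 \<le> a \<and> a \<le> int X})" by (simp add: f_def)
  have "{a \<in> A. 1 \<le> a \<and> a \<le> int X} \<subseteq> {a \<in> A. int Z < a \<and> a \<le> int X} \<union> {1..int Z}" by auto
  moreover have fin: "finite {a \<in> A. int Z < a \<and> a \<le> int X}"
    by (rule finite_subset[of _ "{int Z..int X}"]) auto
  ultimately have "card {a \<in> A. 1 \<le> a \<and> a \<le> int X}
      \<le> card ({a \<in> A. int Z < a \<and> a \<le> int X} \<union> {1..int Z})"
    by (intro card_mono) auto
  also have "\<dots> \<le> card {a \<in> A. int Z < a \<and> a \<le> int X} + card {1..int Z}" by (rule card_Un_le)
  finally have "f x \<le> real (card {a \<in> A. int Z < a \<and> a \<le> int X}) + real Z" using f by simp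
  moreover have "\<alpha> / 2 * x < f x" using x(2) \<open>x > 0\<close> by (simp add: less_divide_eq)
  moreover have "real Z \<le> \<alpha> / 4 * x"
    using x(1) assms(2) by (simp add: x0_def field_simps)
  moreover have "\<alpha> / 4 * real X \<le> \<alpha> / 4 * x" using Xx assms(2) by (intro mult_left_mono) auto
  ultimately have "\<alpha> / 4 * real X \<le> real (card {a \<in> A. int Z < a \<and> a \<le> int X})" by linarith
  moreover have "N \<le> X" using x(1) Xx by (simp add: x0_def)
  ultimately show ?thesis by blast
qed

lemma consecutive_in_between:
  assumes "s \<in> S" "t \<in> S" "s < t"
  shows "\<exists>t'. consecutive_in S s t' \<and> t' \<le> t"
proof -
  have fin: "finite {w \<in> S. s < w \<and> w \<le> t}" by (rule finite_subset[of _ "{s..t}"]) auto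
  define t' where "t' = Min {w \<in> S. s < w \<and> w \<le> t}"
  have "t' \<in> {w \<in> S. s < w \<and> w \<le> t}" unfolding t'_def using assms fin by (intro Min_in) auto
  then have t': "t' \<in> S" "s < t'" "t' \<le> t" by auto
  have least: "t' \<le> w" if "w \<in> S" "s < w" for w
  proof (cases "w \<le> t")
    case True
    then show ?thesis unfolding t'_def using that fin by (intro Min_le) auto
  qed (use t' in simp)
  have "consecutive_in S s t'"
    unfolding consecutive_in_def using assms(1) t' least by (meson leD)
  then show ?thesis using t' by blast
qed

theorem theorem1p4:
  fixes \<epsilon> :: real
  assumes "\<epsilon> > 0"
  shows "\<exists>K::real. K > 0 \<and>
    (\<forall>(\<alpha>::real) (\<beta>::real) (A::int set) (B::int set).
       0 < \<alpha> \<longrightarrow> \<alpha> \<le> 1 \<longrightarrow> 0 < \<beta> \<longrightarrow> \<beta> \<le> 1 \<longrightarrow>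
       infinite A \<longrightarrow> infinite B \<longrightarrow>
       upper_density A = ereal \<alpha> \<longrightarrow> upper_density B = ereal \<beta> \<longrightarrow>
       infinite {(u, v). consecutive_in (A * B) u v \<and>
                         real_of_int (v - u) \<le> K / (\<alpha> * \<beta>) powr (1 + \<epsilon>)})"
proof -
  obtain K where K: "K > 0" "\<And>(X::nat) (Y::nat) A B \<gamma>. A \<subseteq> {1..X} \<Longrightarrow> B \<subseteq> {1..Y} \<Longrightarrow> 0 < \<gamma> \<Longrightarrow>
      \<gamma> * real X * real Y \<le> real (card A) * real (card B) \<Longrightarrow>
      K \<le> real X * real Y * \<gamma> powr (1 + \<epsilon>) \<Longrightarrow>
      \<exists>a\<in>A. \<exists>b\<in>B. \<exists>a'\<in>A. \<exists>b'\<in>B. a * b' < a' * b \<and>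
        real (a' * b) - real (a * b') \<le> K / \<gamma> powr (1 + \<epsilon>)"
    using finite_small_product_gap[OF assms] by metis
  show ?thesis
  proof (intro exI[of _ "K * 16 powr (1 + \<epsilon>)"] conjI allI impI)
    show "K * 16 powr (1 + \<epsilon>) > 0" using K(1) by simp
  next
    fix \<alpha> \<beta> :: real and A B :: "int set"
    assume \<alpha>: "0 < \<alpha>" and \<beta>: "0 < \<beta>"
      and dA: "upper_density A = ereal \<alpha>" and dB: "upper_density B = ereal \<beta>"
    \<comment> \<open>In suitable windows \<open>A\<close> and \<open>B\<close> have densities at least \<open>\<alpha> / 4\<close> and \<open>\<beta> / 4\<close>.\<close>
    define \<gamma> where "\<gamma> = \<alpha> * \<beta> / 16"
    have "0 < \<gamma>" using \<alpha> \<beta> by (simp add: \<gamma>_def)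
    have K_eq: "K / \<gamma> powr (1 + \<epsilon>) = K * 16 powr (1 + \<epsilon>) / (\<alpha> * \<beta>) powr (1 + \<epsilon>)"
      using \<alpha> \<beta> by (simp add: \<gamma>_def powr_divide)
    define Q where "Q = {(u, v). consecutive_in (A * B) u v \<and>
        real_of_int (v - u) \<le> K * 16 powr (1 + \<epsilon>) / (\<alpha> * \<beta>) powr (1 + \<epsilon>)}"
    have unbounded: "\<exists>(u, v)\<in>Q. int Z < u" for Z :: nat
    proof -
      obtain N :: nat where N: "K / \<gamma> powr (1 + \<epsilon>) < real N" using reals_Archimedean2 by blast
      obtain X where X: "X \<ge> N" "\<alpha> / 4 * real X \<le> real (card {a \<in> A. int Z < a \<and> a \<le> int X})"
        using upper_density_dense_window[OF dA \<alpha>] by blast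
      obtain Y where Y: "Y \<ge> 1" "\<beta> / 4 * real Y \<le> real (card {b \<in> B. int Z < b \<and> b \<le> int Y})"
        using upper_density_dense_window[OF dB \<beta>] by blast
      define A' where "A' = nat ` {a \<in> A. int Z < a \<and> a \<le> int X}"
      define B' where "B' = nat ` {b \<in> B. int Z < b \<and> b \<le> int Y}"
      have cA: "card A' = card {a \<in> A. int Z < a \<and> a \<le> int X}"
        unfolding A'_def by (intro card_image) (auto simp: inj_on_def)
      have cB: "card B' = card {b \<in> B. int Z < b \<and> b \<le> int Y}"
        unfolding B'_def by (intro card_image) (auto simp: inj_on_def)
      have A': "int a \<in> A" "Z < a" if "a \<in> A'" for a using that by (auto simp: A'_def)
      have B': "int b \<in> B" "Z < b" if "b \<in> B'" for b using that by (auto simp: B'_def)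
      have "\<gamma> * real X * real Y = (\<alpha> / 4 * real X) * (\<beta> / 4 * real Y)" by (simp add: \<gamma>_def)
      also have "\<dots> \<le> real (card A') * real (card B')"
        unfolding cA cB using X Y \<alpha> \<beta> by (intro mult_mono) auto
      finally have card: "\<gamma> * real X * real Y \<le> real (card A') * real (card B')" .
      have "K / \<gamma> powr (1 + \<epsilon>) \<le> real X * 1" using N X(1) by linarith
      also have "\<dots> \<le> real X * real Y" using Y(1) by (intro mult_left_mono) auto
      finally have large: "K \<le> real X * real Y * \<gamma> powr (1 + \<epsilon>)"
        using \<open>0 < \<gamma>\<close> by (simp add: divide_le_eq)
      have sub: "A' \<subseteq> {1..X}" "B' \<subseteq> {1..Y}" by (auto simp: A'_def B'_def)
      obtain a b a' b' where ab: "a \<in> A'" "b \<in> B'" "a' \<in> A'" "b' \<in> B'" "a * b' < a' * b"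
          "real (a' * b) - real (a * b') \<le> K / \<gamma> powr (1 + \<epsilon>)"
        using K(2)[OF sub \<open>0 < \<gamma>\<close> card large] by blast
      have "int (a * b') \<in> A * B" "int (a' * b) \<in> A * B"
        using A' B' ab by (auto intro: set_times_intro)
      moreover have "int (a * b') < int (a' * b)" using ab(5) by (rule of_nat_less_iff[THEN iffD2])
      ultimately obtain t where t: "consecutive_in (A * B) (int (a * b')) t" "t \<le> int (a' * b)"
        using consecutive_in_between by blast
      have "real_of_int t \<le> real (a' * b)" using t(2) by linarith
      then have "real_of_int (t - int (a * b')) \<le> K / \<gamma> powr (1 + \<epsilon>)"
        using ab(6) by simp
      then have "(int (a * b'), t) \<in> Q" using t(1) by (simp add: Q_def K_eq)
      moreover have "Z < a * b'"
      proof -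
        have "Z < a" "1 \<le> b'" using A'(2)[OF ab(1)] B'(2)[OF ab(4)] by auto
        then show ?thesis by (metis less_le_trans mult.right_neutral mult_le_mono2)
      qed
      then have "int Z < int (a * b')" by (rule of_nat_less_iff[THEN iffD2])
      ultimately show ?thesis by blast
    qed
    have "infinite Q"
    proof
      assume "finite Q"
      then have "finite (fst ` Q)" by simp
      then have "bdd_above (fst ` Q)" by (rule bdd_above_finite)
      then obtain M where M: "\<And>q. q \<in> Q \<Longrightarrow> fst q \<le> M" by (auto simp: bdd_above_def)
      obtain u v where "(u, v) \<in> Q" "int (nat M) < u" using unbounded[of "nat M"] by blast
      moreover from this have "u \<le> M" using M[of "(u, v)"] by simp
      ultimately show False by linarith
    qed
    then show "infinite {(u, v). consecutive_in (A * B) u v \<and>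
        real_of_int (v - u) \<le> K * 16 powr (1 + \<epsilon>) / (\<alpha> * \<beta>) powr (1 + \<epsilon>)}"
      by (simp add: Q_def)
  qed
qed

end
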